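(* Let $0<q_1<q_0\le 1$, let $c\in\left(0,\frac{q_0}{q_0+q_1}\right)$ and let $0<\gamma\le c$ be constants. Let $\{G_n\}_n$ be a $\lambda$-expander family of regular graphs with $\lambda^2\le\frac{q_0}{q_0+q_1}-c$, and consider the biased 2-choices rule on $G_n$ started, for each $n$, from a deterministic state with $A(0)$ agents of opinion $1$ satisfying $$1-\gamma\ \ge\ \frac{A(0)}{n}\ \ge\ \frac{q_1}{q_0+q_1}+\max\left(\lambda_n^2,\sqrt{\frac{\log n}{4n}}\right).$$ Then there exists a constant $\alpha=\alpha(q_0,q_1,\gamma,c)\in(0,1)$ such that, as $n\to\infty$, with probability at least $1-O(1/n^{\alpha})$ consensus is achieved on opinion $1$ (i.e. all agents have opinion $1$) in $$O\left(\frac{\log n}{\log\frac{1}{1-q_1c\left(\frac{q_0}{q_0+q_1}-\gamma\right)}}\right)$$ time steps, where the constants implied by the $O(\cdot)$ notation do not depend on $n$ (they may depend on $q_0,q_1,\gamma,c$).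
   Context: For each $n\ge2$, $G_n=(V_n,E_n)$ is an undirected $d_n$-regular graph with $|V_n|=n$, $d_n\ge1$; $N_u$ is the set of neighbours of $u$. $\lambda_n\ge0$ is the second largest absolute value (with multiplicity) of an eigenvalue of the scaled adjacency matrix of $G_n$ (adjacency matrix divided by $d_n$). $\{G_n\}_n$ is a $\lambda$-expander family if $\lambda_n\le\lambda<1$ for all $n$, with $\lambda\in(0,1)$ a fixed constant. Biased 2-choices rule: each agent (vertex) $u$ has an opinion $X_u^n(t)\in\{0,1\}$ at each time $t=0,1,2,\dots$. In each step all agents update synchronously and, given the current state, independently: an agent $u$ with opinion $i$ keeps opinion $i$ with probability $1-q_i$, and with probability $q_i$ it samples $N_1,N_2\in N_u$ independently and uniformly at random (with replacement) and sets $X_u^n(t+1)=\mathbf 1\{X_u^n(t)+X_{N_1}^n(t)+X_{N_2}^n(t)\ge2\}$, the majority opinion among $u,N_1,N_2$. The process $\mathbf X^n(t)=(X_u^n(t))_{u\in V_n}$ is a Markov chain on $\{0,1\}^n$. $A(t)=A_t$ is the number of agents with opinion $1$ at time $t$. Logarithms are natural. *)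

theory Defs
  imports
    "HOL-Probability.Probability"
    "HOL-Computational_Algebra.Computational_Algebra"
    "Jordan_Normal_Form.Char_Poly"
begin

(* Simple graphs on the vertex set {..<n}, given by their symmetric set of arcs;
   the set of neighbours of u is E `` {u}. *)
definition regular_graph :: "nat \<Rightarrow> nat \<Rightarrow> (nat \<times> nat) set \<Rightarrow> bool" where
  "regular_graph n d E \<longleftrightarrow>
     E \<subseteq> {..<n} \<times> {..<n} \<and> sym E \<and> irrefl E \<and> (\<forall>u<n. card (E `` {u}) = d)"

definition scaled_adjacency :: "nat \<Rightarrow> nat \<Rightarrow> (nat \<times> nat) set \<Rightarrow> real mat" where
  "scaled_adjacency n d E = mat n n (\<lambda>(u, v). of_bool ((u, v) \<in> E) / real d)"

(* For a regular graph the matrix is real symmetric, so all n eigenvalues are real and the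
   multiset of real roots of the characteristic polynomial is the whole spectrum with
   multiplicities. Index 1 of the list sorted in descending order is the second largest entry;
   it is only meaningful for n >= 2. *)
definition second_eigenvalue :: "nat \<Rightarrow> nat \<Rightarrow> (nat \<times> nat) set \<Rightarrow> real" where
  "second_eigenvalue n d E =
     rev (sorted_list_of_multiset
       (image_mset abs (proots (char_poly (scaled_adjacency n d E))))) ! 1"

(* The family is indexed by a set I of sizes. Requiring a member for every n >= 2 would make
   the notion void: the only 1-regular simple graph on two vertices has eigenvalues 1 and -1. *)
definition expander_family ::
  "real \<Rightarrow> nat set \<Rightarrow> (nat \<Rightarrow> nat) \<Rightarrow> (nat \<Rightarrow> (nat \<times> nat) set) \<Rightarrow> bool" where
  "expander_family lam I d E \<longleftrightarrow>
     0 < lam \<and> lam < 1 \<and> I \<subseteq> {2..} \<and>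
     (\<forall>n\<in>I. 1 \<le> d n \<and> regular_graph n (d n) (E n) \<and> second_eigenvalue n (d n) (E n) \<le> lam)"

(* States assign to each vertex its opinion, True for 1 and False for 0; values outside {..<n}
   are irrelevant. *)

definition num_ones :: "nat \<Rightarrow> (nat \<Rightarrow> bool) \<Rightarrow> nat" where
  "num_ones n x = card {u \<in> {..<n}. x u}"

definition update_agent ::
  "real \<Rightarrow> real \<Rightarrow> (nat \<times> nat) set \<Rightarrow> (nat \<Rightarrow> bool) \<Rightarrow> nat \<Rightarrow> bool pmf" where
  "update_agent q0 q1 E x u =
     bind_pmf (bernoulli_pmf (if x u then q1 else q0)) (\<lambda>b.
       if b then
         bind_pmf (pmf_of_set (E `` {u})) (\<lambda>v.
         bind_pmf (pmf_of_set (E `` {u})) (\<lambda>w.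
           return_pmf (of_bool (x u) + of_bool (x v) + of_bool (x w) \<ge> (2 :: nat))))
       else return_pmf (x u))"

definition two_choices_step ::
  "real \<Rightarrow> real \<Rightarrow> nat \<Rightarrow> (nat \<times> nat) set \<Rightarrow> (nat \<Rightarrow> bool) \<Rightarrow> (nat \<Rightarrow> bool) pmf" where
  "two_choices_step q0 q1 n E x = Pi_pmf {..<n} False (update_agent q0 q1 E x)"

(* Law of the trajectory [X(0), ..., X(T)] of the Markov chain started from X(0) = x. *)
primrec two_choices_trajectory ::
  "real \<Rightarrow> real \<Rightarrow> nat \<Rightarrow> (nat \<times> nat) set \<Rightarrow> nat \<Rightarrow> (nat \<Rightarrow> bool) \<Rightarrow> (nat \<Rightarrow> bool) list pmf" where
  "two_choices_trajectory q0 q1 n E 0 x = return_pmf [x]"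
| "two_choices_trajectory q0 q1 n E (Suc T) x =
     bind_pmf (two_choices_step q0 q1 n E x) (\<lambda>y.
       map_pmf (Cons x) (two_choices_trajectory q0 q1 n E T y))"

definition consensus_on_one :: "nat \<Rightarrow> (nat \<Rightarrow> bool) \<Rightarrow> bool" where
  "consensus_on_one n x \<longleftrightarrow> (\<forall>u<n. x u)"

end

theory Submission
  imports Defs "HOL-Real_Asymp.Real_Asymp"
begin

text \<open>
  Write \<open>r = q1 / (q0 + q1)\<close>, let \<open>a\<close> be the fraction of agents of opinion 1, let \<open>L\<close> be the
  square of the second eigenvalue, and let \<open>p u\<close> be the fraction of neighbours of \<open>u\<close> that have
  opinion 1. Given the state, the expected number of ones grows in one step by
  \<open>q0 * (p u)\<^sup>2\<close> summed over the zeros, minus \<open>q1 * (1 - p u)\<^sup>2\<close> summed over the ones. Adding and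
  subtracting \<open>q1 * (1 - p u)\<^sup>2\<close> at the zeros leaves two terms. At a zero,
  \<open>q0 * p\<^sup>2 + q1 * (1 - p)\<^sup>2\<close> is a quadratic in \<open>p\<close> with minimum \<open>q1 * (1 - r)\<close>. The sum of
  \<open>q1 * (1 - p u)\<^sup>2\<close> over all vertices is a squared norm of the averaged indicator of the zeros,
  which the spectral gap bounds by \<open>q1 * n * ((1 - a)\<^sup>2 + L * a * (1 - a))\<close>. Together they give the
  drift bound \<open>q1 * n * (1 - a) * (a * (1 - L) - r)\<close> (lemma \<open>expected_ones_drift\<close>), and everything
  is driven by the margin \<open>m = a * (1 - L) - r\<close>.

  The hypothesis on the initial state makes \<open>m\<close> at least \<open>c * sqrt (ln n / (4 * n))\<close>
  (\<open>margin_initial\<close>). As long as there are more than \<open>\<gamma> * n\<close> zeros, the margin grows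
  in expectation by at least a constant factor larger than 1 in each step. The drift is then at least a constant times
  \<open>sqrt (n * ln n)\<close>, so by Hoeffding's inequality half of it is realised except with
  probability polynomially small in \<open>n\<close>. Since the margin stays below 1, this can last only for
  logarithmically many steps. Once at most \<open>\<gamma> * n\<close> zeros are left, their expected number shrinks by
  the factor \<open>1 - q1 * c * (1 - r - \<gamma>)\<close> in each step, and Hoeffding's inequality keeps it below
  \<open>\<gamma> * n\<close> up to an exponentially small probability; after logarithmically many further steps the
  expected number of zeros is at most \<open>1 / n\<close>, and Markov's inequality finishes the proof
  (\<open>fail_prob_near_consensus\<close>, \<open>fail_prob_bound\<close>).

  The second eigenvalue enters only through the contraction of mean-zero functions
  (\<open>second_eigenvalue_contraction\<close>). It is obtained without diagonalising the adjacency matrix: a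
  maximiser of the Rayleigh quotient on the mean-zero functions produces an eigenfunction, and its
  eigenvalue together with the eigenvalue 1 of the constants occurs in the multiset of
  roots of the characteristic polynomial.
\<close>

section \<open>The averaging operator of a regular graph and its extremal eigenfunction\<close>

lemma quadratic_nonneg_imp_linear_zero:
  fixes a b :: real
  assumes "\<And>t. 0 \<le> 2 * t * a + t\<^sup>2 * b"
  shows "a = 0"
proof (rule ccontr)
  assume a: "a \<noteq> 0"
  define t where "t = - a / (\<bar>b\<bar> + 1)"
  have "2 * t * a + t\<^sup>2 * b \<le> 2 * t * a + t\<^sup>2 * (\<bar>b\<bar> + 1)"
    by (intro add_left_mono mult_left_mono) auto
  also have "\<dots> = - a\<^sup>2 / (\<bar>b\<bar> + 1)"
    by (simp add: t_def power2_eq_square)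
  also have "\<dots> < 0" using a by (auto intro!: divide_neg_pos)
  finally show False using assms[of t] by simp
qed

locale graph_average =
  fixes n d :: nat and E :: "(nat \<times> nat) set"
  assumes graph: "regular_graph n d E" and deg_pos: "1 \<le> d"
begin

lemma nbrs:
  assumes "u < n"
  shows "E `` {u} \<subseteq> {..<n}" "finite (E `` {u})" "card (E `` {u}) = d" "E `` {u} \<noteq> {}"
proof -
  show *: "E `` {u} \<subseteq> {..<n}" and **: "card (E `` {u}) = d"
    using graph assms by (auto simp: regular_graph_def)
  show "finite (E `` {u})" using * finite_subset by blast
  show "E `` {u} \<noteq> {}" using ** deg_pos by auto
qed

text \<open>Multiplication of a vector by the scaled adjacency matrix.\<close>
definition avg :: "(nat \<Rightarrow> real) \<Rightarrow> nat \<Rightarrow> real" where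
  "avg f u = (\<Sum>v<n. of_bool ((u, v) \<in> E) / real d * f v)"

lemma avg_eq: "u < n \<Longrightarrow> avg f u = (\<Sum>v\<in>E `` {u}. f v) / real d"
proof -
  assume u: "u < n"
  have "avg f u = (\<Sum>v\<in>{..<n}. if v \<in> E `` {u} then f v / real d else 0)"
    unfolding avg_def by (rule sum.cong) auto
  also have "\<dots> = (\<Sum>v\<in>{..<n} \<inter> E `` {u}. f v / real d)"
    by (subst sum.inter_restrict) (auto simp: Image_singleton intro: sum.cong)
  also have "{..<n} \<inter> E `` {u} = E `` {u}" using nbrs[OF u] by auto
  finally show ?thesis by (simp add: sum_divide_distrib)
qed

lemma avg_const: "u < n \<Longrightarrow> avg (\<lambda>_. k) u = k"
  using deg_pos by (simp add: avg_eq nbrs)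

lemma avg_linear: "avg (\<lambda>v. a * f v + b * g v) u = a * avg f u + b * avg g u"
  unfolding avg_def sum_distrib_left sum.distrib[symmetric]
  by (rule sum.cong) (auto simp: algebra_simps add_divide_distrib)

lemma avg_cong: "(\<And>v. v < n \<Longrightarrow> f v = g v) \<Longrightarrow> avg f u = avg g u"
  unfolding avg_def by (rule sum.cong) auto

lemma avg_selfadjoint: "(\<Sum>u<n. avg f u * g u) = (\<Sum>u<n. f u * avg g u)"
proof -
  have s: "(u, v) \<in> E \<longleftrightarrow> (v, u) \<in> E" for u v
    using graph by (auto simp: regular_graph_def sym_def)
  have "(\<Sum>u<n. avg f u * g u) = (\<Sum>u<n. \<Sum>v<n. of_bool ((u, v) \<in> E) / real d * f v * g u)"
    by (simp add: avg_def sum_distrib_right)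
  also have "\<dots> = (\<Sum>v<n. \<Sum>u<n. of_bool ((u, v) \<in> E) / real d * f v * g u)"
    by (rule sum.swap)
  also have "\<dots> = (\<Sum>v<n. f v * avg g v)"
    unfolding avg_def sum_distrib_left by (intro sum.cong refl) (simp add: s mult_ac)
  finally show ?thesis .
qed

lemma sum_avg: "(\<Sum>u<n. avg f u) = (\<Sum>u<n. f u)"
  using avg_selfadjoint[of f "\<lambda>_. 1"] by (simp add: avg_const)

text \<open>The dimension is a number and not a type, so a vector is a function on all of \<open>nat\<close>. Those that
  are bounded by 1 below \<open>n\<close> and vanish from \<open>n\<close> on form a product of compact sets, and the unit
  sphere of mean-zero functions is a closed subset of it.\<close>
lemma rayleigh_maximizer:
  assumes "2 \<le> n"
  obtains g where "(\<Sum>u<n. g u) = 0" "(\<Sum>u<n. (g u)\<^sup>2) = 1"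
    "\<And>h. (\<Sum>u<n. h u) = 0 \<Longrightarrow> (\<Sum>u<n. (h u)\<^sup>2) = 1 \<Longrightarrow>
       (\<Sum>u<n. (avg h u)\<^sup>2) \<le> (\<Sum>u<n. (avg g u)\<^sup>2)"
proof -
  define C :: "(nat \<Rightarrow> real) set" where "C = (\<Pi>\<^sub>E u\<in>UNIV. if u < n then {-1..1} else {0})"
  define S where "S = {g :: nat \<Rightarrow> real. (\<Sum>u<n. g u) = 0} \<inter> {g. (\<Sum>u<n. (g u)\<^sup>2) = 1}"
  have coord: "continuous_on UNIV (\<lambda>g :: nat \<Rightarrow> real. g u)" for u
    by (rule continuous_on_product_coordinates)
  have "compactin (product_topology (\<lambda>_. euclidean) UNIV) C"
    unfolding C_def by (subst compactin_PiE) (auto simp: compactin_euclidean_iff)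
  then have "compact C"
    by (simp add: euclidean_product_topology compactin_euclidean_iff)
  moreover have "closed S"
    unfolding S_def by (intro closed_Int closed_Collect_eq continuous_intros coord)
  ultimately have K: "compact (C \<inter> S)" by (rule compact_Int_closed)
  define g0 :: "nat \<Rightarrow> real" where "g0 u = (if u = 0 then 1 / sqrt 2 else if u = 1 then - 1 / sqrt 2 else 0)" for u
  have split01: "{..<n} = insert 0 (insert 1 {2..<n})" using assms by auto
  have "g0 \<in> C \<inter> S"
    using assms unfolding C_def S_def split01
    by (auto simp: g0_def power_divide PiE_def Pi_def divide_le_eq le_divide_eq intro: order_trans[of _ 0])
  then have ne: "C \<inter> S \<noteq> {}" by blast
  have cont: "continuous_on (C \<inter> S) (\<lambda>g. \<Sum>u<n. (avg g u)\<^sup>2)"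
    unfolding avg_def by (intro continuous_intros continuous_on_subset[OF coord]) auto
  obtain g where g: "g \<in> C \<inter> S"
    and max: "\<And>h. h \<in> C \<inter> S \<Longrightarrow> (\<Sum>u<n. (avg h u)\<^sup>2) \<le> (\<Sum>u<n. (avg g u)\<^sup>2)"
    using continuous_attains_sup[OF K ne cont] by blast
  show thesis
  proof (rule that[of g])
    show "(\<Sum>u<n. g u) = 0" "(\<Sum>u<n. (g u)\<^sup>2) = 1" using g by (auto simp: S_def)
    fix h :: "nat \<Rightarrow> real" assume h: "(\<Sum>u<n. h u) = 0" "(\<Sum>u<n. (h u)\<^sup>2) = 1"
    define h' where "h' u = (if u < n then h u else 0)" for u
    have "\<bar>h u\<bar> \<le> 1" if "u < n" for u
    proof -
      have "(h u)\<^sup>2 \<le> (\<Sum>u<n. (h u)\<^sup>2)"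
        using that by (intro member_le_sum) auto
      then show ?thesis using h by (simp add: abs_square_le_1)
    qed
    then have "h' \<in> C \<inter> S"
      using h by (auto simp: h'_def C_def S_def PiE_def Pi_def abs_le_iff)
    moreover have "avg h' u = avg h u" for u by (rule avg_cong) (simp add: h'_def)
    ultimately show "(\<Sum>u<n. (avg h u)\<^sup>2) \<le> (\<Sum>u<n. (avg g u)\<^sup>2)" using max[of h'] by simp
  qed
qed

text \<open>At a maximiser \<open>g\<close> of the Rayleigh quotient with value \<open>\<mu>\<close>, the first variation shows
  that \<open>g\<close> is an eigenfunction of the square of the averaging operator for \<open>\<mu>\<close>. For \<open>s = sqrt \<mu>\<close> the
  square minus \<open>\<mu>\<close> factors into \<open>(avg - s)\<close> and \<open>(avg + s)\<close>: either \<open>avg g + s * g\<close> is nonzero and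
  has eigenvalue \<open>s\<close>, or \<open>g\<close> itself has eigenvalue \<open>- s\<close>.\<close>
lemma exists_extremal_eigenfunction:
  assumes "2 \<le> n"
  obtains w e where "(\<Sum>u<n. w u) = 0" "\<exists>u<n. w u \<noteq> 0" "\<And>u. u < n \<Longrightarrow> avg w u = e * w u"
    "\<And>h. (\<Sum>u<n. h u) = 0 \<Longrightarrow> (\<Sum>u<n. (avg h u)\<^sup>2) \<le> e\<^sup>2 * (\<Sum>u<n. (h u)\<^sup>2)"
proof -
  obtain g where g: "(\<Sum>u<n. g u) = 0" "(\<Sum>u<n. (g u)\<^sup>2) = 1"
    and max: "\<And>h. (\<Sum>u<n. h u) = 0 \<Longrightarrow> (\<Sum>u<n. (h u)\<^sup>2) = 1 \<Longrightarrow>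
       (\<Sum>u<n. (avg h u)\<^sup>2) \<le> (\<Sum>u<n. (avg g u)\<^sup>2)"
    using rayleigh_maximizer[OF assms] by blast
  define \<mu> where "\<mu> = (\<Sum>u<n. (avg g u)\<^sup>2)"
  have mu0: "\<mu> \<ge> 0" unfolding \<mu>_def by (simp add: sum_nonneg)
  have bound: "(\<Sum>u<n. (avg h u)\<^sup>2) \<le> \<mu> * (\<Sum>u<n. (h u)\<^sup>2)" if h: "(\<Sum>u<n. h u) = 0" for h
  proof (cases "(\<Sum>u<n. (h u)\<^sup>2) = 0")
    case True
    then have "h u = 0" if "u < n" for u
      using that by (subst (asm) sum_nonneg_eq_0_iff) auto
    then have "avg h u = 0" for u unfolding avg_def by simp
    then show ?thesis using True by simp
  next
    case False
    define s where "s = (\<Sum>u<n. (h u)\<^sup>2)"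
    have s: "s > 0" using False sum_nonneg[of "{..<n}" "\<lambda>u. (h u)\<^sup>2"] by (simp add: s_def)
    define k where "k u = (1 / sqrt s) * h u + 0 * h u" for u
    have "(\<Sum>u<n. k u) = 0" using h by (simp add: k_def flip: sum_divide_distrib)
    moreover have "(\<Sum>u<n. (k u)\<^sup>2) = 1"
      using s by (simp add: k_def power_divide flip: sum_divide_distrib s_def)
    ultimately have "(\<Sum>u<n. (avg k u)\<^sup>2) \<le> \<mu>" unfolding \<mu>_def by (rule max)
    moreover have "avg k u = avg h u / sqrt s" for u
      unfolding k_def avg_linear by simp
    ultimately have "(\<Sum>u<n. (avg h u)\<^sup>2) / s \<le> \<mu>"
      using s by (simp add: power_divide flip: sum_divide_distrib)
    then show ?thesis using s by (simp add: field_simps s_def)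
  qed
  define r where "r u = \<mu> * g u + (-1) * avg (avg g) u" for u
  have r0: "(\<Sum>u<n. r u) = 0"
    using g by (simp add: r_def sum_subtractf sum_avg flip: sum_distrib_left)
  have rr: "(\<Sum>u<n. (r u)\<^sup>2) = \<mu> * (\<Sum>u<n. g u * r u) - (\<Sum>u<n. avg g u * avg r u)"
  proof -
    have "(\<Sum>u<n. (r u)\<^sup>2) = (\<Sum>u<n. (\<mu> * g u + (-1) * avg (avg g) u) * r u)"
      by (simp only: power2_eq_square flip: r_def)
    also have "\<dots> = \<mu> * (\<Sum>u<n. g u * r u) - (\<Sum>u<n. avg (avg g) u * r u)"
      by (simp add: algebra_simps sum_subtractf sum_distrib_left)
    finally show ?thesis using avg_selfadjoint[of "avg g" r] by simp
  qed
  \<comment> \<open>first variation of the Rayleigh quotient in the direction of its own gradient \<open>r\<close>\<close>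
  have "(\<Sum>u<n. (r u)\<^sup>2) = 0"
  proof (rule quadratic_nonneg_imp_linear_zero)
    fix t :: real
    have "(\<Sum>u<n. 1 * g u + t * r u) = 0" using g r0 by (simp add: sum.distrib flip: sum_distrib_left)
    from bound[OF this] have "0 \<le> \<mu> * (\<Sum>u<n. (1 * g u + t * r u)\<^sup>2) - (\<Sum>u<n. (1 * avg g u + t * avg r u)\<^sup>2)"
      by (simp only: avg_linear diff_ge_0_iff_ge)
    also have "\<dots> = (\<mu> * (\<Sum>u<n. (g u)\<^sup>2) - (\<Sum>u<n. (avg g u)\<^sup>2))
        + 2 * t * (\<mu> * (\<Sum>u<n. g u * r u) - (\<Sum>u<n. avg g u * avg r u))
        + t\<^sup>2 * (\<mu> * (\<Sum>u<n. (r u)\<^sup>2) - (\<Sum>u<n. (avg r u)\<^sup>2))"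
      by (simp add: power2_sum power_mult_distrib sum.distrib sum_distrib_left algebra_simps)
    finally show "0 \<le> 2 * t * (\<Sum>u<n. (r u)\<^sup>2) + t\<^sup>2 * (\<mu> * (\<Sum>u<n. (r u)\<^sup>2) - (\<Sum>u<n. (avg r u)\<^sup>2))"
      using g rr by (simp add: \<mu>_def)
  qed
  then have "r u = 0" if "u < n" for u
    using that by (subst (asm) sum_nonneg_eq_0_iff) auto
  then have gg: "avg (avg g) u = \<mu> * g u" if "u < n" for u using that by (fastforce simp: r_def)
  define s where "s = sqrt \<mu>"
  have s2: "s\<^sup>2 = \<mu>" using mu0 by (simp add: s_def)
  define w where "w u = 1 * avg g u + s * g u" for u
  have w0: "(\<Sum>u<n. w u) = 0"
    using g by (simp add: w_def sum.distrib sum_avg flip: sum_distrib_left)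
  have ww: "avg w u = s * w u" if "u < n" for u
  proof -
    have "avg w u = 1 * avg (avg g) u + s * avg g u" unfolding w_def by (rule avg_linear)
    then show ?thesis using gg[OF that] s2 by (simp add: w_def algebra_simps power2_eq_square)
  qed
  show thesis
  proof (cases "\<exists>u<n. w u \<noteq> 0")
    case True
    show thesis by (rule that[OF w0 True ww]) (use bound s2 in auto)
  next
    case False
    have "\<exists>u<n. g u \<noteq> 0" using g(2) by (intro ccontr[of "\<exists>u<n. g u \<noteq> 0"]) auto
    moreover have "avg g u = (- s) * g u" if "u < n" for u
      using False that by (auto simp: w_def)
    ultimately show thesis by (intro that[of g "- s"]) (use g bound s2 in auto)
  qed
qed

end

section \<open>The spectral gap as a contraction\<close>

lemma eigenfunction_imp_char_poly_root:
  fixes A :: "'a :: field mat"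
  assumes A: "A \<in> carrier_mat n n"
    and eig: "\<And>u. u < n \<Longrightarrow> (\<Sum>v<n. A $$ (u, v) * w v) = e * w u"
    and nz: "\<exists>u<n. w u \<noteq> 0"
  shows "poly (char_poly A) e = 0"
proof -
  have "A *\<^sub>v vec n w = e \<cdot>\<^sub>v vec n w"
  proof (rule eq_vecI)
    fix u assume "u < dim_vec (e \<cdot>\<^sub>v vec n w)"
    then show "(A *\<^sub>v vec n w) $ u = (e \<cdot>\<^sub>v vec n w) $ u"
      using A eig[of u] by (auto simp: scalar_prod_def atLeast0LessThan)
  qed (use A in auto)
  moreover have "vec n w \<noteq> 0\<^sub>v n" using nz by (auto simp: vec_eq_iff)
  ultimately have "eigenvalue A e"
    unfolding eigenvalue_def eigenvector_def using A by (intro exI[of _ "vec n w"]) auto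
  then show ?thesis using eigenvalue_root_char_poly[OF A] by simp
qed

text \<open>If the eigenspace of \<open>e\<close> has dimension at least two, it contains for every \<open>i\<close> a nonzero vector
  that vanishes at \<open>i\<close>; this is the form in which the hypothesis is used. Deleting row and column
  \<open>i\<close> keeps that vector an eigenvector, so \<open>e\<close> is a root of the characteristic polynomial of every
  such minor. Their sum is the derivative of the characteristic polynomial.\<close>
lemma char_poly_double_root:
  fixes A :: "'a :: field mat"
  assumes A: "A \<in> carrier_mat n n" and n: "0 < n"
    and eig: "\<And>i. i < n \<Longrightarrow> \<exists>w. w i = 0 \<and> (\<exists>u<n. w u \<noteq> 0) \<and>
      (\<forall>u<n. (\<Sum>v<n. A $$ (u, v) * w v) = e * w u)"
  shows "2 \<le> order e (char_poly A)"
proof -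
  let ?p = "char_poly A"
  have p0: "?p \<noteq> 0" using degree_monic_char_poly[OF A] by auto
  have root: "poly ?p e = 0"
    using eig[OF n] eigenfunction_imp_char_poly_root[OF A] by blast
  have "poly (char_poly (mat_delete A i i)) e = 0" if i: "i < n" for i
  proof -
    obtain w where w: "w i = 0" "\<exists>u<n. w u \<noteq> 0"
      and ew: "\<And>u. u < n \<Longrightarrow> (\<Sum>v<n. A $$ (u, v) * w v) = e * w u"
      using eig[OF i] by blast
    have im: "insert_index i ` {..<n - 1} = {..<n} - {i}"
      using insert_index_image[of i "n - 1"] i by (simp add: atLeast0LessThan)
    have inj: "inj_on (insert_index i) {..<n - 1}"
      using insert_index_inj_on by blast
    have ii: "insert_index i u < n" if "u < n - 1" for u using im that by auto
    show ?thesis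
    proof (rule eigenfunction_imp_char_poly_root[of _ "n - 1" "\<lambda>u. w (insert_index i u)"])
      show "mat_delete A i i \<in> carrier_mat (n - 1) (n - 1)" by (rule mat_delete_carrier[OF A])
      obtain u where u: "u < n" "w u \<noteq> 0" using w by blast
      then have "u \<in> insert_index i ` {..<n - 1}" using im w by auto
      then show "\<exists>u<n - 1. w (insert_index i u) \<noteq> 0" using u by auto
      fix u assume u: "u < n - 1"
      have "(\<Sum>v<n - 1. mat_delete A i i $$ (u, v) * w (insert_index i v)) =
          (\<Sum>v<n - 1. A $$ (insert_index i u, insert_index i v) * w (insert_index i v))"
        using A u by (intro sum.cong) (auto simp: mat_delete_def insert_index_def)
      also have "\<dots> = (\<Sum>v\<in>{..<n} - {i}. A $$ (insert_index i u, v) * w v)"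
        unfolding im[symmetric] by (subst sum.reindex[OF inj]) simp
      also have "\<dots> = (\<Sum>v<n. A $$ (insert_index i u, v) * w v)"
        using w(1) by (intro sum.mono_neutral_left) auto
      finally show "(\<Sum>v<n - 1. mat_delete A i i $$ (u, v) * w (insert_index i v)) =
          e * w (insert_index i u)" using ew[OF ii[OF u]] by simp
    qed
  qed
  then have dp: "poly (pderiv ?p) e = 0"
    by (simp add: pderiv_char_poly[OF A] poly_sum)
  obtain q where q: "?p = [:- e, 1:] * q" using root by (auto simp: poly_eq_0_iff_dvd dvd_def)
  have "poly q e = 0" using dp unfolding q by (simp add: pderiv_mult pderiv_pCons del: mult_pCons_left)
  then obtain r where "q = [:- e, 1:] * r" by (auto simp: poly_eq_0_iff_dvd dvd_def)
  then have "?p = [:- e, 1:] ^ 2 * r" unfolding q power2_eq_square by (simp only: mult.assoc)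
  then have "[:- e, 1:] ^ 2 dvd ?p" by (simp only: dvd_triv_left)
  then show ?thesis using p0 by (simp add: order_max)
qed

lemma second_largest_ge:
  fixes M :: "'a :: linorder multiset"
  assumes "{#a, b#} \<subseteq># M"
  shows "min a b \<le> rev (sorted_list_of_multiset M) ! 1"
proof -
  define l where "l = rev (sorted_list_of_multiset M)"
  have ml: "mset l = M" by (simp add: l_def)
  have sorted: "sorted_wrt (\<ge>) l"
    by (simp add: l_def sorted_wrt_rev sorted_sorted_list_of_multiset)
  have "2 \<le> length l" using size_mset_mono[OF assms] by (simp flip: ml)
  then obtain x y zs where l: "l = x # y # zs"
    by (auto simp: numeral_2_eq_2 Suc_le_length_iff)
  have "min a b \<le> y"
  proof (rule ccontr)
    assume "\<not> min a b \<le> y"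
    then have *: "\<not> min a b \<le> z" if "z \<in># mset (y # zs)" for z
      using that sorted l by (auto simp: not_le intro: le_less_trans)
    let ?F = "filter_mset ((\<le>) (min a b))"
    have "size (?F {#a, b#}) \<le> size (?F (mset l))"
      using assms ml by (intro size_mset_mono multiset_filter_mono) simp
    also have "?F (mset (y # zs)) = {#}"
      using * by (simp only: filter_mset_eq_mempty_iff) blast
    then have "?F (mset l) = ?F {#x#}" by (simp add: l)
    also have "size \<dots> \<le> size {#x#}" by (rule size_filter_mset_lesseq)
    finally show False by simp
  qed
  then show ?thesis by (simp add: l flip: l_def)
qed

context graph_average
begin

text \<open>The constants and \<open>g\<close> are independent eigenfunctions, so \<open>1\<close> and \<open>e\<close> are both roots of the
  characteristic polynomial, and \<open>1\<close> is a double root in the case \<open>e = 1\<close>.\<close>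
lemma eigenfunction_le_second_eigenvalue:
  assumes g0: "(\<Sum>u<n. g u) = 0" and nz: "\<exists>u<n. g u \<noteq> 0"
    and eig: "\<And>u. u < n \<Longrightarrow> avg g u = e * g u"
  shows "min 1 \<bar>e\<bar> \<le> second_eigenvalue n d E"
proof -
  define A where "A = scaled_adjacency n d E"
  have A: "A \<in> carrier_mat n n" by (simp add: A_def scaled_adjacency_def)
  have n: "0 < n" using nz by auto
  have entry: "(\<Sum>v<n. A $$ (u, v) * f v) = avg f u" if "u < n" for u f
    unfolding avg_def using that by (intro sum.cong) (auto simp: A_def scaled_adjacency_def)
  have p0: "char_poly A \<noteq> 0" using degree_monic_char_poly[OF A] by auto
  have root_e: "poly (char_poly A) e = 0"
    by (rule eigenfunction_imp_char_poly_root[OF A _ nz]) (simp add: entry eig)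
  have root_1: "poly (char_poly A) 1 = 0"
    by (rule eigenfunction_imp_char_poly_root[OF A, of "\<lambda>_. 1"]) (use n entry[of _ "\<lambda>_. 1"] in \<open>auto simp: avg_const\<close>)
  have "{#1, e#} \<subseteq># proots (char_poly A)"
  proof (cases "e = 1")
    case False
    have "order 1 (char_poly A) > 0" "order e (char_poly A) > 0"
      using root_1 root_e p0 by (auto simp: order_root)
    then show ?thesis using False p0 by (auto simp: subseteq_mset_def)
  next
    case True
    have "2 \<le> order 1 (char_poly A)"
    proof (rule char_poly_double_root[OF A n])
      fix i assume i: "i < n"
      \<comment> \<open>the combination of \<open>g\<close> with the constants that vanishes at \<open>i\<close>\<close>
      define w where "w v = 1 * g v + (- g i) * 1" for v
      have "\<exists>u<n. w u \<noteq> 0"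
      proof (rule ccontr)
        assume "\<not> ?thesis"
        then have gi: "g u = g i" if "u < n" for u using that by (auto simp: w_def)
        then have "(\<Sum>u<n. g u) = n * g i" by simp
        then have "g i = 0" using g0 n by simp
        with gi nz show False by auto
      qed
      moreover have "avg w u = w u" if "u < n" for u
        unfolding w_def avg_linear using that True by (simp add: eig avg_const)
      ultimately show "\<exists>w. w i = 0 \<and> (\<exists>u<n. w u \<noteq> 0) \<and> (\<forall>u<n. (\<Sum>v<n. A $$ (u, v) * w v) = 1 * w u)"
        by (intro exI[of _ w] conjI allI impI) (simp_all add: entry, simp add: w_def)
    qed
    then show ?thesis using p0 True by (auto simp: subseteq_mset_def)
  qed
  then have "{#1, \<bar>e\<bar>#} \<subseteq># image_mset abs (proots (char_poly A))"
    using image_mset_subseteq_mono[of "{#1, e#}" _ abs] by simp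
  then show ?thesis unfolding second_eigenvalue_def A_def[symmetric] by (rule second_largest_ge)
qed

text \<open>The strict gap discards the alternative \<open>1\<close> in the previous minimum.\<close>
lemma second_eigenvalue_contraction:
  assumes "2 \<le> n" and gap: "second_eigenvalue n d E < 1"
  shows "0 \<le> second_eigenvalue n d E"
    and "(\<Sum>u<n. h u) = 0 \<Longrightarrow>
      (\<Sum>u<n. (avg h u)\<^sup>2) \<le> (second_eigenvalue n d E)\<^sup>2 * (\<Sum>u<n. (h u)\<^sup>2)"
proof -
  obtain w e where w: "(\<Sum>u<n. w u) = 0" "\<exists>u<n. w u \<noteq> 0" "\<And>u. u < n \<Longrightarrow> avg w u = e * w u"
    and bound: "\<And>h. (\<Sum>u<n. h u) = 0 \<Longrightarrow> (\<Sum>u<n. (avg h u)\<^sup>2) \<le> e\<^sup>2 * (\<Sum>u<n. (h u)\<^sup>2)"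
    by (rule exists_extremal_eigenfunction[OF assms(1)]) (rule that)
  have e: "\<bar>e\<bar> \<le> second_eigenvalue n d E"
    using eigenfunction_le_second_eigenvalue[OF w] gap by auto
  then show "0 \<le> second_eigenvalue n d E" by linarith
  have "e\<^sup>2 \<le> (second_eigenvalue n d E)\<^sup>2" using e abs_le_square_iff[of e "second_eigenvalue n d E"] by linarith
  then show "(\<Sum>u<n. (avg h u)\<^sup>2) \<le> (second_eigenvalue n d E)\<^sup>2 * (\<Sum>u<n. (h u)\<^sup>2)"
    if "(\<Sum>u<n. h u) = 0"
    by (rule order_trans[OF bound[OF that] mult_right_mono]) (auto intro: sum_nonneg)
qed

text \<open>An indicator of density \<open>b\<close> splits orthogonally into the constant \<open>b\<close>, which averaging
  preserves, and a mean-zero part of squared norm \<open>n * b * (1 - b)\<close>, which averaging contracts.\<close>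
lemma sum_avg_indicator_square_le:
  fixes b L :: real
  assumes gap: "\<And>h. (\<Sum>u<n. h u) = 0 \<Longrightarrow> (\<Sum>u<n. (avg h u)\<^sup>2) \<le> L * (\<Sum>u<n. (h u)\<^sup>2)"
    and b: "real n * b = (\<Sum>u<n. of_bool (z u))"
  shows "(\<Sum>u<n. (avg (\<lambda>v. of_bool (z v)) u)\<^sup>2) \<le> n * (b\<^sup>2 + L * (b * (1 - b)))"
proof -
  define f where "f v = (of_bool (z v) :: real)" for v
  have sf: "(\<Sum>u<n. f u) = n * b" using b by (simp add: f_def)
  have "(f u)\<^sup>2 = f u" for u by (simp add: f_def)
  then have sf2: "(\<Sum>u<n. (f u)\<^sup>2) = n * b" using sf by simp
  have af: "(\<Sum>u<n. avg f u) = n * b" using sf by (simp only: sum_avg)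
  define h where "h v = 1 * f v + (- b) * 1" for v
  have "(\<Sum>u<n. (avg h u)\<^sup>2) = (\<Sum>u<n. (avg f u - b)\<^sup>2)"
    unfolding h_def avg_linear by (intro sum.cong) (auto simp: avg_const)
  also have "\<dots> = (\<Sum>u<n. (avg f u)\<^sup>2) - 2 * b * (\<Sum>u<n. avg f u) + n * b\<^sup>2"
    by (simp add: power2_diff sum.distrib sum_subtractf sum_distrib_left mult_ac)
  finally have 1: "(\<Sum>u<n. (avg f u)\<^sup>2) = (\<Sum>u<n. (avg h u)\<^sup>2) + n * b\<^sup>2"
    by (simp add: af power2_eq_square)
  have "(\<Sum>u<n. (h u)\<^sup>2) = (\<Sum>u<n. (f u)\<^sup>2) - 2 * b * (\<Sum>u<n. f u) + n * b\<^sup>2"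
    by (simp add: h_def power2_diff sum.distrib sum_subtractf sum_distrib_left mult_ac)
  then have 2: "(\<Sum>u<n. (h u)\<^sup>2) = n * (b * (1 - b))"
    unfolding sf sf2 by (simp add: power2_eq_square algebra_simps)
  have "(\<Sum>u<n. h u) = 0" by (simp add: h_def sum_subtractf sf)
  from gap[OF this] have "(\<Sum>u<n. (avg f u)\<^sup>2) \<le> n * (b\<^sup>2 + L * (b * (1 - b)))"
    unfolding 1 2 by (simp add: algebra_simps)
  then show ?thesis unfolding f_def .
qed

end

section \<open>One step of the process\<close>

lemma num_ones_eq_sum: "real (num_ones n x) = (\<Sum>u<n. of_bool (x u))"
  unfolding num_ones_def by (simp add: Collect_conj_eq lessThan_def)

lemma expectation_Pi_pmf_of_bool:
  fixes u n :: nat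
  assumes "u < n"
  shows "measure_pmf.expectation (Pi_pmf {..<n} False p) (\<lambda>y. of_bool (y u) :: real) = pmf (p u) True"
proof -
  let ?M = "Pi_pmf {..<n} False p"
  have "measure_pmf.expectation ?M (\<lambda>y. of_bool (y u)) =
      measure_pmf.expectation (map_pmf (\<lambda>y. y u) ?M) (of_bool :: bool \<Rightarrow> real)" by simp
  also have "map_pmf (\<lambda>y. y u) ?M = p u" using assms by (subst Pi_pmf_component) auto
  also have "measure_pmf.expectation (p u) (of_bool :: bool \<Rightarrow> real) = pmf (p u) True"
    by (subst integral_measure_pmf[of UNIV]) (auto simp: UNIV_bool)
  finally show ?thesis .
qed

lemma expectation_num_ones_Pi_pmf:
  "measure_pmf.expectation (Pi_pmf {..<n} False p) (\<lambda>y. real (num_ones n y))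
    = (\<Sum>u<n. pmf (p u) True)"
proof -
  have "integrable (measure_pmf (Pi_pmf {..<n} False p)) (\<lambda>y. of_bool (y u) :: real)" for u
    by (rule measure_pmf.integrable_const_bound[of _ 1]) auto
  then show ?thesis
    unfolding num_ones_eq_sum
    by (subst Bochner_Integration.integral_sum) (auto simp: expectation_Pi_pmf_of_bool)
qed

lemma Pi_pmf_bool_lower_tail:
  fixes p :: "nat \<Rightarrow> bool pmf" and t :: real
  assumes "0 < n" "0 \<le> t"
  shows "measure_pmf.prob (Pi_pmf {..<n} False p)
      {y. real (num_ones n y) \<le> (\<Sum>u<n. pmf (p u) True) - t} \<le> exp (- 2 * t\<^sup>2 / n)"
proof -
  let ?M = "Pi_pmf {..<n} False p"
  interpret Hoeffding_ineq "measure_pmf ?M" "{..<n}" "\<lambda>u y. of_bool (y u)" "\<lambda>_. 0" "\<lambda>_. 1"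
    "\<Sum>u<n. pmf (p u) True"
  proof unfold_locales
    show "prob_space.indep_vars (measure_pmf ?M) (\<lambda>_. borel) (\<lambda>u y. of_bool (y u) :: real) {..<n}"
      by (intro prob_space.indep_vars_compose2[OF _ indep_vars_Pi_pmf])
         (auto simp: measure_pmf.prob_space_axioms)
  next
    show "(\<Sum>u<n. pmf (p u) True) \<equiv> (\<Sum>u<n. measure_pmf.expectation ?M (\<lambda>y. of_bool (y u)))"
      by (intro eq_reflection sum.cong) (auto simp: expectation_Pi_pmf_of_bool)
  qed auto
  show ?thesis using Hoeffding_ineq_le[of t] assms by (simp add: num_ones_eq_sum)
qed

context graph_average
begin

lemma pmf_update_agent_True:
  fixes x :: "nat \<Rightarrow> bool"
  assumes u: "u < n" and q: "0 \<le> q0" "q0 \<le> 1" "0 \<le> q1" "q1 \<le> 1"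
  defines "\<beta> \<equiv> avg (\<lambda>v. of_bool (\<not> x v)) u"
  shows "pmf (update_agent q0 q1 E x u) True =
    (if x u then 1 - q1 * \<beta>\<^sup>2 else q0 * (1 - \<beta>)\<^sup>2)"
proof -
  let ?N = "E `` {u}"
  note N = nbrs[OF u]
  have d: "real d > 0" using deg_pos by simp
  define z where "z v = (of_bool (\<not> x v) :: real)" for v
  have \<beta>: "\<beta> = (\<Sum>v\<in>?N. z v) / d" unfolding \<beta>_def avg_eq[OF u] z_def ..
  have ones: "(\<Sum>v\<in>?N. 1 - z v) = d * (1 - \<beta>)"
    using d by (simp add: \<beta> sum_subtractf N algebra_simps)
  define D where "D = bind_pmf (pmf_of_set ?N) (\<lambda>v. bind_pmf (pmf_of_set ?N) (\<lambda>w.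
           return_pmf (of_bool (x u) + of_bool (x v) + of_bool (x w) \<ge> (2 :: nat))))"
  have D: "pmf D True = (\<Sum>v\<in>?N. \<Sum>w\<in>?N.
      of_bool (of_bool (x u) + of_bool (x v) + of_bool (x w) \<ge> (2 :: nat))) / (real d)\<^sup>2"
    unfolding D_def
    by (simp add: pmf_bind integral_pmf_of_set N indicator_def power2_eq_square
          sum_divide_distrib of_bool_def)
  have main: "pmf D True = (if x u then 1 - \<beta>\<^sup>2 else (1 - \<beta>)\<^sup>2)"
  proof (cases "x u")
    case True
    have "(\<Sum>v\<in>?N. \<Sum>w\<in>?N. of_bool (of_bool (x u) + of_bool (x v) + of_bool (x w) \<ge> (2 :: nat)))
        = (\<Sum>v\<in>?N. \<Sum>w\<in>?N. 1 - z v * z w)"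
      using True by (intro sum.cong) (auto simp: z_def)
    also have "\<dots> = (real d)\<^sup>2 - (\<Sum>v\<in>?N. z v)\<^sup>2"
      by (simp add: sum_subtractf N power2_eq_square sum_product)
    finally show ?thesis unfolding D \<beta> using True d by (simp add: field_simps)
  next
    case False
    have "(\<Sum>v\<in>?N. \<Sum>w\<in>?N. of_bool (of_bool (x u) + of_bool (x v) + of_bool (x w) \<ge> (2 :: nat)))
        = (\<Sum>v\<in>?N. \<Sum>w\<in>?N. (1 - z v) * (1 - z w))"
      using False by (intro sum.cong) (auto simp: z_def)
    also have "\<dots> = (real d * (1 - \<beta>))\<^sup>2"
      unfolding ones[symmetric] by (simp add: power2_eq_square sum_product)
    finally show ?thesis unfolding D power_mult_distrib using False d by simp
  qed
  have "update_agent q0 q1 E x u =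
      bind_pmf (bernoulli_pmf (if x u then q1 else q0)) (\<lambda>b. if b then D else return_pmf (x u))"
    unfolding update_agent_def D_def ..
  then have "pmf (update_agent q0 q1 E x u) True =
      pmf D True * (if x u then q1 else q0) + of_bool (x u) * (1 - (if x u then q1 else q0))"
    using q by (simp add: pmf_bind)
  then show ?thesis unfolding main by (cases "x u") (simp_all add: algebra_simps)
qed

text \<open>The agents of opinion 1 are lost at the rate \<open>q1 * (\<beta> u)\<^sup>2\<close>. Charging this loss to the zeros as
  well makes the total loss a full squared norm, to which the spectral bound applies, and by
  \<open>quad\<close> every zero still gains at least \<open>q1 * s\<close>, whatever its neighbourhood.\<close>
lemma expected_ones_drift:
  fixes L :: real and x :: "nat \<Rightarrow> bool"
  assumes gap: "\<And>h. (\<Sum>u<n. h u) = 0 \<Longrightarrow> (\<Sum>u<n. (avg h u)\<^sup>2) \<le> L * (\<Sum>u<n. (h u)\<^sup>2)"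
    and n: "0 < n" and q: "0 \<le> q0" "q0 \<le> 1" "0 < q1" "q1 \<le> 1"
  defines "a \<equiv> num_ones n x / n"
  shows "n * (a + q1 * (1 - a) * (a * (1 - L) - q1 / (q0 + q1)))
    \<le> (\<Sum>u<n. pmf (update_agent q0 q1 E x u) True)"
proof -
  define \<beta> where "\<beta> = avg (\<lambda>v. of_bool (\<not> x v))"
  define s where "s = q0 / (q0 + q1)"
  have s: "q1 / (q0 + q1) = 1 - s" using q by (simp add: s_def field_simps)
  have ones: "n * a = (\<Sum>u<n. of_bool (x u))" using n by (simp add: a_def flip: num_ones_eq_sum)
  have zeros: "(\<Sum>u<n. of_bool (\<not> x u)) = n * (1 - a)"
  proof -
    have "(\<Sum>u<n. of_bool (\<not> x u)) = (\<Sum>u<n. 1 - (of_bool (x u) :: real))"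
      by (rule sum.cong) auto
    then show ?thesis
      using n by (simp add: sum_subtractf a_def right_diff_distrib num_ones_eq_sum)
  qed
  have quad: "q1 * s \<le> q0 * (1 - b)\<^sup>2 + q1 * b\<^sup>2" for b
  proof -
    have "(q0 * (1 - b)\<^sup>2 + q1 * b\<^sup>2) * (q0 + q1) - q0 * q1 = ((q0 + q1) * b - q0)\<^sup>2"
      by (simp add: power2_eq_square algebra_simps)
    then have "0 \<le> (q0 * (1 - b)\<^sup>2 + q1 * b\<^sup>2) * (q0 + q1) - q0 * q1" by simp
    then show ?thesis using q by (simp add: s_def field_simps)
  qed
  have "n * (a + q1 * (1 - a) * (a * (1 - L) - (1 - s)))
      = n * a + q1 * (s * (n * (1 - a)) - n * ((1 - a)\<^sup>2 + L * ((1 - a) * (1 - (1 - a)))))"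
    by (simp add: power2_eq_square algebra_simps)
  also have "\<dots> \<le> n * a + q1 * (s * (n * (1 - a)) - (\<Sum>u<n. (\<beta> u)\<^sup>2))"
    unfolding \<beta>_def using q zeros
    by (intro add_left_mono mult_left_mono diff_left_mono sum_avg_indicator_square_le gap) auto
  also have "\<dots> = (\<Sum>u<n. of_bool (x u) + (q1 * s * of_bool (\<not> x u) - q1 * (\<beta> u)\<^sup>2))"
    unfolding ones zeros[symmetric]
    by (simp only: sum.distrib sum_subtractf sum_distrib_left[symmetric] mult.assoc right_diff_distrib)
  also have "\<dots> \<le> (\<Sum>u<n. pmf (update_agent q0 q1 E x u) True)"
    by (rule sum_mono) (use quad q in \<open>auto simp: pmf_update_agent_True \<beta>_def diff_le_eq\<close>)
  finally show ?thesis unfolding s .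
qed

end

section \<open>The probability of missing consensus\<close>

definition fail_prob ::
  "real \<Rightarrow> real \<Rightarrow> nat \<Rightarrow> (nat \<times> nat) set \<Rightarrow> nat \<Rightarrow> (nat \<Rightarrow> bool) \<Rightarrow> real" where
  "fail_prob q0 q1 n E T x = measure_pmf.prob (two_choices_trajectory q0 q1 n E T x)
     {xs. \<not> (\<exists>x\<in>set xs. consensus_on_one n x)}"

lemma measure_bind_pmf:
  "measure_pmf.prob (bind_pmf M f) S = measure_pmf.expectation M (\<lambda>x. measure_pmf.prob (f x) S)"
  using measurable_measure_pmf[of f] unfolding measure_pmf_bind
  by (subst measure_pmf.measure_bind[where N = "count_space UNIV"]) auto

lemma fail_prob_0: "fail_prob q0 q1 n E 0 x = of_bool (\<not> consensus_on_one n x)"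
  by (simp add: fail_prob_def measure_return_pmf indicator_def)

lemma fail_prob_Suc:
  "fail_prob q0 q1 n E (Suc T) x = (if consensus_on_one n x then 0
     else measure_pmf.expectation (two_choices_step q0 q1 n E x) (fail_prob q0 q1 n E T))"
proof -
  have "measure_pmf.prob (map_pmf (Cons x) (two_choices_trajectory q0 q1 n E T y))
      {xs. \<not> (\<exists>x\<in>set xs. consensus_on_one n x)} =
      (if consensus_on_one n x then 0 else fail_prob q0 q1 n E T y)" for y
    by (auto simp: fail_prob_def vimage_def)
  then show ?thesis by (auto simp: fail_prob_def[of _ _ _ _ "Suc T"] measure_bind_pmf)
qed

lemma fail_prob_le_1: "fail_prob q0 q1 n E T x \<le> 1"
  by (simp add: fail_prob_def)

lemma fail_prob_nonneg: "0 \<le> fail_prob q0 q1 n E T x"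
  by (simp add: fail_prob_def)

lemma integrable_two_choices_step [simp]:
  fixes f :: "(nat \<Rightarrow> bool) \<Rightarrow> real"
  shows "integrable (measure_pmf (two_choices_step q0 q1 n E x)) f"
proof (rule integrable_measure_pmf_finite)
  have "finite (PiE_dflt {..<n} False (set_pmf \<circ> update_agent q0 q1 E x))"
    by (rule finite_PiE_dflt) auto
  then show "finite (set_pmf (two_choices_step q0 q1 n E x))"
    unfolding two_choices_step_def by (rule finite_subset[OF set_Pi_pmf_subset', rotated]) simp
qed

text \<open>A bad successor state can be counted as a failure, so that induction hypotheses are needed only
  at the good ones.\<close>
lemma fail_prob_Suc_le:
  fixes g :: "(nat \<Rightarrow> bool) \<Rightarrow> real"
  assumes good: "\<And>y. y \<notin> B \<Longrightarrow> fail_prob q0 q1 n E T y \<le> g y"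
    and g: "\<And>y. 0 \<le> g y"
    and bad: "measure_pmf.prob (two_choices_step q0 q1 n E x) B \<le> \<epsilon>"
  shows "fail_prob q0 q1 n E (Suc T) x
    \<le> measure_pmf.expectation (two_choices_step q0 q1 n E x) g + \<epsilon>"
proof -
  let ?M = "two_choices_step q0 q1 n E x"
  have "fail_prob q0 q1 n E (Suc T) x \<le> measure_pmf.expectation ?M (fail_prob q0 q1 n E T)"
    by (simp add: fail_prob_Suc integral_nonneg fail_prob_nonneg)
  also have "\<dots> \<le> measure_pmf.expectation ?M (\<lambda>y. g y + indicator B y)"
  proof (rule integral_mono)
    fix y
    show "fail_prob q0 q1 n E T y \<le> g y + indicator B y"
      using good[of y] g[of y] fail_prob_le_1[of q0 q1 n E T y] by (auto simp: indicator_def)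
  qed simp_all
  also have "\<dots> = measure_pmf.expectation ?M g + measure_pmf.prob ?M B"
    by (subst Bochner_Integration.integral_add) simp_all
  finally show ?thesis using bad by simp
qed

lemma shrink_rate_bounds:
  fixes q0 q1 c \<gamma> :: real
  assumes "0 < q1" "q1 < q0" "q0 \<le> 1" "0 < c" "c < q0 / (q0 + q1)" "0 < \<gamma>" "\<gamma> \<le> c"
  shows "0 < q1 * c * (q0 / (q0 + q1) - \<gamma>)" "q1 * c * (q0 / (q0 + q1) - \<gamma>) < 1"
proof -
  have "q0 / (q0 + q1) < 1" using assms by simp
  then have *: "c < 1" "q0 / (q0 + q1) - \<gamma> < 1" "0 < q0 / (q0 + q1) - \<gamma>"
    using assms by linarith+
  then show "0 < q1 * c * (q0 / (q0 + q1) - \<gamma>)" using assms by simp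
  have "q1 * c * (q0 / (q0 + q1) - \<gamma>) < 1 * 1 * 1"
    using assms * by (intro mult_strict_mono) simp_all
  then show "q1 * c * (q0 / (q0 + q1) - \<gamma>) < 1" by simp
qed

text \<open>The process sees the graph only through a contraction constant \<open>L\<close> for mean-zero functions;
  in the application this is the square of the second eigenvalue.\<close>
locale biased_two_choices = graph_average +
  fixes q0 q1 c \<gamma> L :: real
  assumes q: "0 < q1" "q1 < q0" "q0 \<le> 1"
    and c: "0 < c" "c < q0 / (q0 + q1)"
    and \<gamma>: "0 < \<gamma>" "\<gamma> \<le> c"
    and n: "0 < n"
    and L: "0 \<le> L" "L \<le> q0 / (q0 + q1) - c"
    and gap: "\<And>h. (\<Sum>u<n. h u) = 0 \<Longrightarrow> (\<Sum>u<n. (avg h u)\<^sup>2) \<le> L * (\<Sum>u<n. (h u)\<^sup>2)"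
begin

definition ones_frac :: "(nat \<Rightarrow> bool) \<Rightarrow> real" where
  "ones_frac x = real (num_ones n x) / real n"

text \<open>The lower bound for the drift is the margin times \<open>q1\<close> times the number of zeros. The margin is
  affine in the fraction of ones, so a drift of the ones is a drift of the margin.\<close>
definition margin :: "(nat \<Rightarrow> bool) \<Rightarrow> real" where
  "margin x = ones_frac x * (1 - L) - q1 / (q0 + q1)"

definition mean_ones :: "(nat \<Rightarrow> bool) \<Rightarrow> real" where
  "mean_ones x = (\<Sum>u<n. pmf (update_agent q0 q1 E x u) True)"

abbreviation shrink :: real where
  "shrink \<equiv> q1 * c * (q0 / (q0 + q1) - \<gamma>)"

lemma threshold_eq: "q1 / (q0 + q1) = 1 - q0 / (q0 + q1)"
  using q by (simp add: field_simps)

lemma q0_share_bounds: "0 < q0 / (q0 + q1)" "q0 / (q0 + q1) < 1"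
  using q by (auto simp: field_simps)

lemma shrink_bounds: "0 < shrink" "shrink < 1"
  using shrink_rate_bounds[OF q c \<gamma>] by auto

lemma ones_frac_bounds: "0 \<le> ones_frac x" "ones_frac x \<le> 1"
proof -
  have "num_ones n x \<le> card {..<n}" unfolding num_ones_def by (rule card_mono) auto
  then show "0 \<le> ones_frac x" "ones_frac x \<le> 1" using n by (auto simp: ones_frac_def)
qed

lemma num_ones_eq_ones_frac: "real (num_ones n x) = n * ones_frac x"
  using n by (simp add: ones_frac_def)

lemma consensus_iff_ones_frac: "consensus_on_one n x \<longleftrightarrow> ones_frac x = 1"
proof -
  have "consensus_on_one n x \<longleftrightarrow> {u \<in> {..<n}. x u} = {..<n}"
    by (auto simp: consensus_on_one_def)
  also have "\<dots> \<longleftrightarrow> num_ones n x = n"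
  proof
    assume "num_ones n x = n"
    then show "{u \<in> {..<n}. x u} = {..<n}"
      unfolding num_ones_def by (intro card_subset_eq) auto
  next
    assume "{u \<in> {..<n}. x u} = {..<n}"
    then show "num_ones n x = n" unfolding num_ones_def by (simp only: card_lessThan)
  qed
  finally show ?thesis using n by (auto simp: ones_frac_def)
qed

lemma zeros_ge_1: "\<not> consensus_on_one n x \<Longrightarrow> 1 \<le> n * (1 - ones_frac x)"
proof -
  assume *: "\<not> consensus_on_one n x"
  have "real (num_ones n x) \<le> n" "real (num_ones n x) \<noteq> n"
    using ones_frac_bounds[of x] * n unfolding consensus_iff_ones_frac by (auto simp: ones_frac_def)
  then have "num_ones n x < n" by (simp only: of_nat_le_iff of_nat_eq_iff)
  then have "real (num_ones n x) + 1 \<le> n" by simp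
  then show ?thesis unfolding num_ones_eq_ones_frac by (simp add: right_diff_distrib)
qed

lemma mean_ones_ge: "n * (ones_frac x + q1 * (1 - ones_frac x) * margin x) \<le> mean_ones x"
  unfolding mean_ones_def margin_def ones_frac_def
  by (rule expected_ones_drift[OF gap]) (use n q in auto)

text \<open>This is where \<open>\<gamma> \<le> c\<close> is needed: near consensus the margin is at least
  \<open>c - \<gamma> * (1 - s + c)\<close> for \<open>s = q0 / (q0 + q1)\<close>, and this is \<open>c * (s - \<gamma>) + (c - \<gamma>) * (1 - s)\<close>.\<close>
lemma margin_near_consensus:
  assumes "1 - ones_frac x \<le> \<gamma>"
  shows "q1 * margin x \<ge> shrink"
proof -
  define s where "s = q0 / (q0 + q1)"
  note r = threshold_eq[folded s_def] and s = q0_share_bounds[folded s_def] and L' = L[folded s_def]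
  have "c * (s - \<gamma>) \<le> margin x"
  proof -
    have "(1 - \<gamma>) * (1 - s + c) \<le> ones_frac x * (1 - L)"
      using assms L' c \<gamma> s c(2)[folded s_def] by (intro mult_mono) auto
    moreover have "\<gamma> * (1 - s) \<le> c * (1 - s)"
      using \<gamma> s by (intro mult_right_mono) auto
    ultimately show ?thesis unfolding margin_def r by (simp add: algebra_simps)
  qed
  from mult_left_mono[OF this, of q1] q show ?thesis by (simp add: mult.assoc s_def)
qed

lemma step_lower_tail:
  "0 \<le> t \<Longrightarrow> measure_pmf.prob (two_choices_step q0 q1 n E x)
     {y. n * ones_frac y \<le> mean_ones x - t} \<le> exp (- 2 * t\<^sup>2 / n)"
  unfolding num_ones_eq_ones_frac[symmetric] mean_ones_def two_choices_step_def
  using n by (rule Pi_pmf_bool_lower_tail)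

lemma expectation_zeros:
  "measure_pmf.expectation (two_choices_step q0 q1 n E x) (\<lambda>y. n * (1 - ones_frac y)) = n - mean_ones x"
proof -
  have "measure_pmf.expectation (two_choices_step q0 q1 n E x) (\<lambda>y. n * (1 - ones_frac y))
      = measure_pmf.expectation (two_choices_step q0 q1 n E x) (\<lambda>y. n - real (num_ones n y))"
    by (simp add: num_ones_eq_ones_frac right_diff_distrib)
  also have "\<dots> = n - measure_pmf.expectation (two_choices_step q0 q1 n E x) (\<lambda>y. real (num_ones n y))"
    by (subst Bochner_Integration.integral_diff) simp_all
  finally show ?thesis
    unfolding two_choices_step_def expectation_num_ones_Pi_pmf mean_ones_def .
qed

text \<open>With few zeros left, their number contracts in expectation by \<open>1 - shrink\<close>, so leaving the
  region requires a deviation of at least \<open>n * shrink * \<gamma>\<close> from the mean; this costs the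
  exponential term in each step. At the end, failure means that at least one zero is left, so the
  expected number of zeros bounds its probability.\<close>
lemma fail_prob_near_consensus:
  assumes "1 - ones_frac x \<le> \<gamma>"
  shows "fail_prob q0 q1 n E T x
    \<le> (1 - shrink) ^ T * (n * (1 - ones_frac x)) + T * exp (- 2 * (shrink * \<gamma>)\<^sup>2 * n)"
  using assms
proof (induction T arbitrary: x)
  case 0
  then show ?case
    using zeros_ge_1[of x] ones_frac_bounds[of x] by (simp add: fail_prob_0)
next
  case (Suc T)
  let ?e = "exp (- 2 * (shrink * \<gamma>)\<^sup>2 * n)"
  let ?g = "\<lambda>y. (1 - shrink) ^ T * (n * (1 - ones_frac y)) + T * ?e"
  have mean: "n - mean_ones x \<le> n * (1 - ones_frac x) * (1 - shrink)"
  proof -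
    have "n * (1 - ones_frac x) * shrink \<le> n * (1 - ones_frac x) * (q1 * margin x)"
      using margin_near_consensus[OF Suc.prems] ones_frac_bounds[of x] by (intro mult_left_mono) auto
    then show ?thesis using mean_ones_ge[of x] by (simp add: algebra_simps)
  qed
  let ?B = "{y. n * ones_frac y \<le> mean_ones x - n * (shrink * \<gamma>)}"
  have "fail_prob q0 q1 n E (Suc T) x
      \<le> measure_pmf.expectation (two_choices_step q0 q1 n E x) ?g + ?e"
  proof (rule fail_prob_Suc_le)
    show "0 \<le> ?g y" for y using shrink_bounds ones_frac_bounds[of y] by simp
    have "measure_pmf.prob (two_choices_step q0 q1 n E x) ?B
        \<le> exp (- 2 * (n * (shrink * \<gamma>))\<^sup>2 / n)"
      by (rule step_lower_tail) (use \<gamma> shrink_bounds in simp)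
    also have "- 2 * (n * (shrink * \<gamma>))\<^sup>2 / n = - 2 * (shrink * \<gamma>)\<^sup>2 * n"
      using n by (simp add: power2_eq_square)
    finally show "measure_pmf.prob (two_choices_step q0 q1 n E x) ?B \<le> ?e" .
    fix y assume "y \<notin> ?B"
    then have y: "n * ones_frac y > mean_ones x - n * (shrink * \<gamma>)" by simp
    have "n * (1 - ones_frac x) * (1 - shrink) \<le> n * \<gamma> * (1 - shrink)"
      using Suc.prems shrink_bounds by (intro mult_right_mono mult_left_mono) auto
    then have "n * (1 - ones_frac y) < n * \<gamma>" using y mean by (simp add: algebra_simps)
    then have "1 - ones_frac y \<le> \<gamma>" using n by simp
    then show "fail_prob q0 q1 n E T y \<le> ?g y" by (rule Suc.IH)
  qed
  also have "measure_pmf.expectation (two_choices_step q0 q1 n E x) ?g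
      = (1 - shrink) ^ T * (n - mean_ones x) + T * ?e"
    unfolding expectation_zeros[symmetric]
    by (subst Bochner_Integration.integral_add) (simp_all add: measure_pmf.prob_space)
  also have "\<dots> \<le> (1 - shrink) ^ T * (n * (1 - ones_frac x) * (1 - shrink)) + T * ?e"
    using mean shrink_bounds by (intro add_right_mono mult_left_mono) auto
  finally show ?case by (simp add: algebra_simps)
qed

text \<open>Half of the guaranteed drift is enough to multiply the margin by a fixed factor, because
  \<open>1 - L \<ge> c\<close> and more than a fraction \<open>\<gamma>\<close> of the agents are zeros.\<close>
lemma margin_growth:
  assumes far: "\<gamma> < 1 - ones_frac x" and pos: "0 \<le> margin x"
    and y: "mean_ones x - n * (q1 * \<gamma> * margin x / 2) < n * ones_frac y"
  shows "margin x * (1 + c * q1 * \<gamma> / 2) \<le> margin y"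
proof -
  have "\<gamma> * (q1 * margin x) \<le> (1 - ones_frac x) * (q1 * margin x)"
    using far pos q by (intro mult_right_mono) auto
  then have "n * (\<gamma> * (q1 * margin x)) \<le> n * ((1 - ones_frac x) * (q1 * margin x))"
    by (intro mult_left_mono) auto
  then have "n * (ones_frac x + q1 * \<gamma> * margin x / 2) \<le> n * ones_frac y"
    using mean_ones_ge[of x] y by (simp add: algebra_simps)
  then have fy: "ones_frac x + q1 * \<gamma> * margin x / 2 \<le> ones_frac y" using n by simp
  have cL: "c \<le> 1 - L" using L q0_share_bounds by simp
  have "margin x + c * (q1 * \<gamma> * margin x / 2) \<le> margin x + (1 - L) * (q1 * \<gamma> * margin x / 2)"
    using cL pos q \<gamma> by (intro add_left_mono mult_right_mono) auto
  also have "\<dots> = (ones_frac x + q1 * \<gamma> * margin x / 2) * (1 - L) - q1 / (q0 + q1)"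
    by (simp add: margin_def algebra_simps)
  also have "\<dots> \<le> ones_frac y * (1 - L) - q1 / (q0 + q1)"
    using fy cL c by (intro diff_right_mono mult_right_mono) auto
  also have "\<dots> = margin y" by (simp only: margin_def)
  finally show ?thesis by (simp add: algebra_simps)
qed

lemma margin_less_1: "margin x < 1"
proof -
  have "ones_frac x * (1 - L) \<le> 1 * 1" using ones_frac_bounds[of x] L c q0_share_bounds by (intro mult_mono) auto
  moreover have "q1 / (q0 + q1) > 0" using q by simp
  ultimately show ?thesis by (simp add: margin_def)
qed

text \<open>The growth hypothesis says that \<open>j\<close> successful steps far from consensus would push the margin up
  to 1, which is impossible; so the process comes near consensus within fewer than \<open>j\<close> successful
  steps, and then \<open>t\<close> steps remain for the second phase. The number \<open>\<theta>\<close> is a lower bound for the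
  margin during the whole first phase, and hence for its drift.\<close>
lemma fail_prob_bound:
  assumes \<theta>: "0 \<le> \<theta>" "\<theta> \<le> margin x"
    and growth: "1 \<le> margin x * (1 + c * q1 * \<gamma> / 2) ^ j"
    and \<epsilon>1: "exp (- 2 * (shrink * \<gamma>)\<^sup>2 * n) \<le> \<epsilon>"
    and \<epsilon>2: "exp (- (q1 * \<gamma> * \<theta>)\<^sup>2 * n / 2) \<le> \<epsilon>"
  shows "fail_prob q0 q1 n E (j + t) x \<le> (1 - shrink) ^ t * n + (j + t) * \<epsilon>"
  using \<theta> growth
proof (induction j arbitrary: x)
  case 0
  then show ?case using margin_less_1[of x] by simp
next
  case (Suc j)
  have \<epsilon>: "0 \<le> \<epsilon>" using \<epsilon>1 by (rule order_trans[OF exp_ge_zero])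
  show ?case
  proof (cases "1 - ones_frac x \<le> \<gamma>")
    case True
    have "fail_prob q0 q1 n E (Suc j + t) x
      \<le> (1 - shrink) ^ (Suc j + t) * (n * (1 - ones_frac x)) + (Suc j + t) * exp (- 2 * (shrink * \<gamma>)\<^sup>2 * n)"
      by (rule fail_prob_near_consensus[OF True])
    also have "\<dots> \<le> (1 - shrink) ^ t * n + (Suc j + t) * \<epsilon>"
      using shrink_bounds ones_frac_bounds[of x] \<epsilon>1 mult_left_mono[of "1 - ones_frac x" 1 n]
      by (intro add_mono mult_mono power_decreasing) auto
    finally show ?thesis by (simp add: add.assoc)
  next
    case False
    then have far: "\<gamma> < 1 - ones_frac x" by simp
    \<comment> \<open>half of the expected increase in the number of ones\<close>
    let ?t = "n * (q1 * \<gamma> * margin x / 2)"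
    let ?B = "{y. n * ones_frac y \<le> mean_ones x - ?t}"
    let ?g = "\<lambda>_ :: nat \<Rightarrow> bool. (1 - shrink) ^ t * n + (real j + real t) * \<epsilon>"
    have "fail_prob q0 q1 n E (Suc (j + t)) x
        \<le> measure_pmf.expectation (two_choices_step q0 q1 n E x) ?g + \<epsilon>"
    proof (rule fail_prob_Suc_le)
      show "0 \<le> ?g y" for y using shrink_bounds \<epsilon> by simp
      have "measure_pmf.prob (two_choices_step q0 q1 n E x) ?B \<le> exp (- 2 * ?t\<^sup>2 / n)"
        by (rule step_lower_tail) (use \<gamma> q Suc.prems in simp)
      also have "- 2 * ?t\<^sup>2 / n = - (q1 * \<gamma> * margin x)\<^sup>2 * n / 2"
        using n by (simp add: power2_eq_square)
      also have "exp \<dots> \<le> exp (- (q1 * \<gamma> * \<theta>)\<^sup>2 * n / 2)"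
        using q \<gamma> Suc.prems by (auto intro!: divide_right_mono mult_right_mono power_mono mult_left_mono)
      finally show "measure_pmf.prob (two_choices_step q0 q1 n E x) ?B \<le> \<epsilon>"
        using \<epsilon>2 by simp
      fix y assume "y \<notin> ?B"
      then have grow: "margin x * (1 + c * q1 * \<gamma> / 2) \<le> margin y"
        using Suc.prems by (intro margin_growth far) auto
      have \<rho>: "0 \<le> c * q1 * \<gamma> / 2" using q c \<gamma> by simp
      have "margin x \<le> margin x * (1 + c * q1 * \<gamma> / 2)"
        using Suc.prems \<rho> mult_left_mono[of 1 "1 + c * q1 * \<gamma> / 2" "margin x"] by simp
      then have "\<theta> \<le> margin y" using grow Suc.prems by linarith
      moreover have "1 \<le> margin y * (1 + c * q1 * \<gamma> / 2) ^ j"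
      proof -
        have "1 \<le> margin x * (1 + c * q1 * \<gamma> / 2) * (1 + c * q1 * \<gamma> / 2) ^ j"
          using Suc.prems by (simp add: mult.assoc)
        also have "\<dots> \<le> margin y * (1 + c * q1 * \<gamma> / 2) ^ j"
          using grow \<rho> by (intro mult_right_mono) auto
        finally show ?thesis .
      qed
      ultimately show "fail_prob q0 q1 n E (j + t) y \<le> ?g y"
        using Suc.prems by (intro Suc.IH) auto
    qed
    then show ?thesis by (simp add: algebra_simps)
  qed
qed

text \<open>Starting above \<open>r + L\<close> for \<open>r = q1 / (q0 + q1)\<close> suffices for a positive margin since
  \<open>(r + L) * (1 - L) - r = L * (1 - r - L)\<close> and \<open>1 - r - L \<ge> c\<close>; the maximum with \<open>s\<close> makes it as
  large as the fluctuations.\<close>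
lemma margin_initial:
  assumes "q1 / (q0 + q1) + max L s \<le> ones_frac x"
  shows "c * s \<le> margin x"
proof -
  let ?r = "q1 / (q0 + q1)"
  have "c * s \<le> c * max L s" using c by (intro mult_left_mono) auto
  also have "\<dots> \<le> (1 - L - ?r) * max L s"
    using L unfolding threshold_eq by (intro mult_right_mono) auto
  also have "\<dots> \<le> (?r + max L s) * (1 - L) - ?r"
  proof -
    have "?r * L \<le> ?r * max L s" using q by (intro mult_left_mono) auto
    then show ?thesis by (simp only: algebra_simps)
  qed
  also have "\<dots> \<le> margin x"
    unfolding margin_def using assms L c q0_share_bounds
    by (intro diff_right_mono mult_right_mono) auto
  finally show ?thesis .
qed

text \<open>Both phases proceed at an exponential rate of at least \<open>\<beta>\<close>. Splitting \<open>6 * ln n / \<beta>\<close> steps into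
  two halves leaves, after rounding, at least \<open>2 * ln n / \<beta>\<close> for each of them. In the first, the
  growth factor reaches \<open>n ^ 2\<close>, more than enough to lift the initial margin to 1; in the second,
  at most \<open>n\<close> zeros shrink to an expected \<open>1 / n\<close>. The exponent of \<open>n\<close> is the Hoeffding exponent of
  a deviation by half of the drift at the initial margin.\<close>
lemma fail_prob_logarithmic_time:
  fixes \<beta> :: real
  defines "T \<equiv> nat \<lfloor>6 * ln n / \<beta>\<rfloor>"
  assumes \<beta>: "0 < \<beta>" "\<beta> \<le> ln (1 + c * q1 * \<gamma> / 2)" "\<beta> \<le> ln (1 / (1 - shrink))"
    and large: "\<beta> \<le> ln n" "1 \<le> c * sqrt (ln n / (4 * n)) * n ^ 2"
    and start: "q1 / (q0 + q1) + max L (sqrt (ln n / (4 * n))) \<le> ones_frac x"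
  shows "fail_prob q0 q1 n E T x \<le>
    1 / n + 6 * ln n / \<beta> * (n powr - ((q1 * \<gamma> * c)\<^sup>2 / 8) + exp (- 2 * (shrink * \<gamma>)\<^sup>2 * n))"
proof -
  define j where "j = T div 2"
  define t where "t = T - j"
  define l where "l = ln (real n)"
  define \<theta> where "\<theta> = c * sqrt (l / (4 * n))"
  define \<epsilon> where "\<epsilon> = n powr - ((q1 * \<gamma> * c)\<^sup>2 / 8) + exp (- 2 * (shrink * \<gamma>)\<^sup>2 * n)"
  have l: "\<beta> \<le> l" "0 < l" using large \<beta> by (auto simp: l_def)
  have en: "exp l = n" using n by (simp add: l_def)
  have T: "6 * l / \<beta> - 1 < T" "T \<le> 6 * l / \<beta>"
    using l \<beta> unfolding T_def l_def[symmetric] by (auto simp: of_nat_nat)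
  have "1 \<le> l / \<beta>" using l \<beta> by simp
  moreover have "T \<le> 2 * j + 1" "T = j + t" "j \<le> t" by (auto simp: j_def t_def)
  ultimately have "2 * l / \<beta> \<le> j" "2 * l / \<beta> \<le> t" using T by linarith+
  then have jt: "2 * l \<le> j * \<beta>" "2 * l \<le> t * \<beta>" using \<beta> by (simp_all add: field_simps)
  have sq: "exp (2 * l) = n ^ 2" by (simp add: en exp_double)
  have j: "n ^ 2 \<le> (1 + c * q1 * \<gamma> / 2) ^ j"
  proof -
    have pos: "0 < 1 + c * q1 * \<gamma> / 2" using c q \<gamma> by (simp add: add_pos_nonneg)
    have "2 * l \<le> j * ln (1 + c * q1 * \<gamma> / 2)"
      using jt(1) \<beta>(2) by (meson mult_left_mono of_nat_0_le_iff order_trans)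
    then have "exp (2 * l) \<le> exp (j * ln (1 + c * q1 * \<gamma> / 2))" by simp
    then show ?thesis using pos by (simp add: sq exp_of_nat_mult)
  qed
  have t: "(1 - shrink) ^ t * n \<le> 1 / n"
  proof -
    have pos: "0 < 1 - shrink" using shrink_bounds by simp
    have "2 * l \<le> t * ln (1 / (1 - shrink))"
      using jt(2) \<beta>(3) by (meson mult_left_mono of_nat_0_le_iff order_trans)
    then have "t * ln (1 - shrink) \<le> - (2 * l)" using pos by (simp add: ln_div)
    then have "exp (t * ln (1 - shrink)) \<le> exp (- (2 * l))" by simp
    then have "(1 - shrink) ^ t \<le> 1 / n ^ 2"
      using pos by (simp add: exp_of_nat_mult exp_minus sq inverse_eq_divide)
    then have "(1 - shrink) ^ t * n \<le> 1 / n ^ 2 * n" by (rule mult_right_mono) simp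
    then show ?thesis using n by (simp add: power2_eq_square)
  qed
  have \<theta>: "0 \<le> \<theta>" "\<theta> \<le> margin x"
    using c l margin_initial[OF start] by (auto simp: \<theta>_def l_def)
  have "fail_prob q0 q1 n E (j + t) x \<le> (1 - shrink) ^ t * n + (real j + real t) * \<epsilon>"
  proof (rule fail_prob_bound[OF \<theta>])
    have "1 \<le> \<theta> * n ^ 2" using large(2) by (simp add: \<theta>_def l_def)
    also have "\<dots> \<le> margin x * (1 + c * q1 * \<gamma> / 2) ^ j"
      using \<theta> j by (intro mult_mono) auto
    finally show "1 \<le> margin x * (1 + c * q1 * \<gamma> / 2) ^ j" .
    show "exp (- 2 * (shrink * \<gamma>)\<^sup>2 * n) \<le> \<epsilon>" by (simp add: \<epsilon>_def)
    have "\<theta>\<^sup>2 * n = c\<^sup>2 * l / 4" using l n by (simp add: \<theta>_def power_mult_distrib)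
    then have "(q1 * \<gamma>)\<^sup>2 * (\<theta>\<^sup>2 * n) / 2 = (q1 * \<gamma> * c)\<^sup>2 / 8 * l"
      by (simp only: power_mult_distrib) simp
    then have "exp (- (q1 * \<gamma> * \<theta>)\<^sup>2 * n / 2) = n powr - ((q1 * \<gamma> * c)\<^sup>2 / 8)"
      using n by (simp add: powr_def l_def power_mult_distrib mult.assoc)
    then show "exp (- (q1 * \<gamma> * \<theta>)\<^sup>2 * n / 2) \<le> \<epsilon>" by (simp add: \<epsilon>_def)
  qed
  also have "\<dots> \<le> 1 / n + 6 * l / \<beta> * \<epsilon>"
  proof (intro add_mono t mult_right_mono)
    show "real j + real t \<le> 6 * l / \<beta>" using T(2) by (simp add: j_def t_def)
    show "0 \<le> \<epsilon>" by (simp add: \<epsilon>_def)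
  qed
  finally show ?thesis by (simp add: \<epsilon>_def l_def j_def t_def)
qed

end

section \<open>Consensus in logarithmic time\<close>

text \<open>The logarithmic number of steps, each failing with probability about \<open>n powr - \<kappa>\<close>, is absorbed by
  halving the exponent.\<close>
lemma eventually_error_terms_small:
  fixes c \<beta> \<kappa> \<mu> :: real
  assumes "0 < c" "0 < \<beta>" "0 < \<kappa>" "\<kappa> < 1" "0 < \<mu>"
  shows "eventually (\<lambda>n :: nat. \<beta> \<le> ln n \<and> 1 \<le> c * sqrt (ln n / (4 * n)) * n ^ 2 \<and>
    1 / n + 6 * ln n / \<beta> * (n powr - \<kappa> + exp (- \<mu> * n)) \<le> 1 / n powr (\<kappa> / 2)) at_top"
proof -
  have k: "\<kappa> / 2 < 1" "\<kappa> / 2 < \<kappa>" "0 < \<kappa> / 2" using assms by auto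
  have "eventually (\<lambda>n :: nat. \<beta> \<le> ln n) at_top" using assms by real_asymp
  moreover have "eventually (\<lambda>n :: nat. 1 \<le> c * sqrt (ln n / (4 * n)) * n ^ 2) at_top"
    using assms by real_asymp
  moreover have "eventually (\<lambda>n :: nat. 1 / n \<le> (1 / 3) * n powr - (\<kappa> / 2)) at_top"
    using assms k by real_asymp
  moreover have "eventually (\<lambda>n :: nat. 6 * ln n / \<beta> * n powr - \<kappa> \<le> (1 / 3) * n powr - (\<kappa> / 2)) at_top"
    using assms k by real_asymp
  moreover have "eventually (\<lambda>n :: nat. 6 * ln n / \<beta> * exp (- \<mu> * n) \<le> (1 / 3) * n powr - (\<kappa> / 2)) at_top"
    using assms k by real_asymp
  ultimately show ?thesis
  proof eventually_elim
    case (elim n)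
    have "1 / n + 6 * ln n / \<beta> * (n powr - \<kappa> + exp (- \<mu> * n))
        = 1 / n + 6 * ln n / \<beta> * n powr - \<kappa> + 6 * ln n / \<beta> * exp (- \<mu> * n)"
      by (simp only: distrib_left add.assoc)
    also have "\<dots> \<le> (1 / 3) * n powr - (\<kappa> / 2) + (1 / 3) * n powr - (\<kappa> / 2) + (1 / 3) * n powr - (\<kappa> / 2)"
      using elim by (intro add_mono) auto
    also have "\<dots> = 1 / n powr (\<kappa> / 2)" by (simp add: powr_minus divide_simps)
    finally show ?case using elim by blast
  qed
qed

theorem theorem2:
  fixes q0 q1 c \<gamma> :: real
  assumes "0 < q1" and "q1 < q0" and "q0 \<le> 1"
    and "0 < c" and "c < q0 / (q0 + q1)"
    and "0 < \<gamma>" and "\<gamma> \<le> c"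
  shows "\<exists>\<alpha> C K :: real. \<exists>n0 :: nat. 0 < \<alpha> \<and> \<alpha> < 1 \<and> 0 < C \<and> 0 < K \<and>
    (\<forall>(lam :: real) (I :: nat set) (d :: nat \<Rightarrow> nat) (E :: nat \<Rightarrow> (nat \<times> nat) set)
       (x0 :: nat \<Rightarrow> nat \<Rightarrow> bool).
      expander_family lam I d E \<longrightarrow>
      lam\<^sup>2 \<le> q0 / (q0 + q1) - c \<longrightarrow>
      (\<forall>n\<in>I. 1 - \<gamma> \<ge> real (num_ones n (x0 n)) / real n \<and>
         real (num_ones n (x0 n)) / real n \<ge>
           q1 / (q0 + q1)
           + max ((second_eigenvalue n (d n) (E n))\<^sup>2) (sqrt (ln (real n) / (4 * real n)))) \<longrightarrow>
      (\<forall>n\<in>I. n \<ge> n0 \<longrightarrow>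
         measure_pmf.prob
           (two_choices_trajectory q0 q1 n (E n)
             (nat \<lfloor>K * (ln (real n) / ln (1 / (1 - q1 * c * (q0 / (q0 + q1) - \<gamma>))))\<rfloor>) (x0 n))
           {xs. \<exists>x\<in>set xs. consensus_on_one n x}
         \<ge> 1 - C / real n powr \<alpha>))"
proof -
  define \<eta> where "\<eta> = q1 * c * (q0 / (q0 + q1) - \<gamma>)"
  define \<rho> where "\<rho> = c * q1 * \<gamma> / 2"
  \<comment> \<open>the slower of the two exponential rates: growth of the margin, decay of the zeros\<close>
  define \<beta> where "\<beta> = min (ln (1 + \<rho>)) (ln (1 / (1 - \<eta>)))"
  define \<kappa> where "\<kappa> = (q1 * \<gamma> * c)\<^sup>2 / 8"
  define \<mu> where "\<mu> = 2 * (\<eta> * \<gamma>)\<^sup>2"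
  have \<rho>: "0 < \<rho>" using assms by (simp add: \<rho>_def)
  have \<eta>: "0 < \<eta>" and \<eta>1: "\<eta> < 1" using shrink_rate_bounds[OF assms] by (simp_all add: \<eta>_def)
  define \<Lambda> where "\<Lambda> = ln (1 / (1 - \<eta>))"
  have \<Lambda>: "0 < \<Lambda>" using \<eta> \<eta>1 by (simp add: \<Lambda>_def)
  have \<beta>: "0 < \<beta>" using \<rho> \<Lambda> by (simp add: \<beta>_def \<Lambda>_def)
  have \<kappa>: "0 < \<kappa>" using assms by (simp add: \<kappa>_def)
  have "q0 / (q0 + q1) < 1" using assms by simp
  then have "c < 1" "\<gamma> < 1" using assms by linarith+
  then have "q1 * \<gamma> * c \<le> 1 * 1 * 1" using assms by (intro mult_mono) auto
  then have "(q1 * \<gamma> * c)\<^sup>2 \<le> 1\<^sup>2" using assms by (intro power_mono) auto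
  then have \<kappa>1: "\<kappa> < 1" by (simp add: \<kappa>_def)
  have \<mu>: "0 < \<mu>" using \<eta> assms by (simp add: \<mu>_def)
  obtain n0 :: nat where n0: "\<forall>n\<ge>n0. \<beta> \<le> ln n \<and> 1 \<le> c * sqrt (ln n / (4 * n)) * n ^ 2 \<and>
    1 / n + 6 * ln n / \<beta> * (n powr - \<kappa> + exp (- \<mu> * n)) \<le> 1 / n powr (\<kappa> / 2)"
    using eventually_error_terms_small[OF \<open>0 < c\<close> \<beta> \<kappa> \<kappa>1 \<mu>] unfolding eventually_at_top_linorder ..
  have main: "measure_pmf.prob
      (two_choices_trajectory q0 q1 n E (nat \<lfloor>6 * \<Lambda> / \<beta> * (ln (real n) / \<Lambda>)\<rfloor>) x)
      {xs. \<exists>x\<in>set xs. consensus_on_one n x} \<ge> 1 - 1 / real n powr (\<kappa> / 2)"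
    if graph: "regular_graph n d E" "1 \<le> d" "2 \<le> n" "second_eigenvalue n d E \<le> lam" "lam < 1"
      and lam: "lam\<^sup>2 \<le> q0 / (q0 + q1) - c"
      and start: "real (num_ones n x) / real n \<ge> q1 / (q0 + q1)
           + max ((second_eigenvalue n d E)\<^sup>2) (sqrt (ln (real n) / (4 * real n)))"
      and large: "n0 \<le> n" for n d E x and lam :: real
  proof -
    interpret G: graph_average n d E by unfold_locales (use graph in auto)
    have lt1: "second_eigenvalue n d E < 1" using graph by linarith
    note contraction = G.second_eigenvalue_contraction[OF \<open>2 \<le> n\<close> lt1]
    have "(second_eigenvalue n d E)\<^sup>2 \<le> lam\<^sup>2"
      using graph contraction(1) by (intro power_mono) auto
    then interpret biased_two_choices n d E q0 q1 c \<gamma> "(second_eigenvalue n d E)\<^sup>2"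
      using assms graph lam contraction(2) by unfold_locales auto
    let ?T = "nat \<lfloor>6 * ln (real n) / \<beta>\<rfloor>"
    have "fail_prob q0 q1 n E ?T x \<le> 1 / n + 6 * ln n / \<beta> *
        (n powr - ((q1 * \<gamma> * c)\<^sup>2 / 8) + exp (- 2 * (\<eta> * \<gamma>)\<^sup>2 * n))"
      unfolding \<eta>_def
      by (rule fail_prob_logarithmic_time)
        (use \<beta> n0[rule_format, OF large] start in \<open>auto simp: \<beta>_def \<rho>_def \<eta>_def ones_frac_def\<close>)
    also have "\<dots> \<le> 1 / n powr (\<kappa> / 2)" using n0[rule_format, OF large] by (simp add: \<kappa>_def \<mu>_def)
    finally have fail: "fail_prob q0 q1 n E ?T x \<le> 1 / n powr (\<kappa> / 2)" .
    let ?P = "two_choices_trajectory q0 q1 n E ?T x"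
    let ?S = "{xs. \<exists>x\<in>set xs. consensus_on_one n x}"
    have "fail_prob q0 q1 n E ?T x = measure_pmf.prob ?P (space ?P - ?S)"
      unfolding fail_prob_def by (rule arg_cong[where f = "measure_pmf.prob _"]) auto
    also have "\<dots> = 1 - measure_pmf.prob ?P ?S" by (rule measure_pmf.prob_compl) simp
    finally have "measure_pmf.prob ?P ?S \<ge> 1 - 1 / n powr (\<kappa> / 2)" using fail by linarith
    moreover have "6 * \<Lambda> / \<beta> * (ln (real n) / \<Lambda>) = 6 * ln (real n) / \<beta>" using \<Lambda> by simp
    ultimately show ?thesis by (simp only:)
  qed
  show ?thesis
  proof (rule exI[of _ "\<kappa> / 2"], rule exI[of _ 1], rule exI[of _ "6 * \<Lambda> / \<beta>"], rule exI[of _ n0],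
      intro conjI allI impI ballI)
    fix lam :: real and I d E and x0 :: "nat \<Rightarrow> nat \<Rightarrow> bool" and n
    assume fam: "expander_family lam I d E" and lam: "lam\<^sup>2 \<le> q0 / (q0 + q1) - c"
      and start: "\<forall>n\<in>I. 1 - \<gamma> \<ge> real (num_ones n (x0 n)) / real n \<and>
         real (num_ones n (x0 n)) / real n \<ge> q1 / (q0 + q1)
           + max ((second_eigenvalue n (d n) (E n))\<^sup>2) (sqrt (ln (real n) / (4 * real n)))"
      and n: "n \<in> I" "n0 \<le> n"
    show "1 - 1 / real n powr (\<kappa> / 2) \<le> measure_pmf.prob
           (two_choices_trajectory q0 q1 n (E n)
             (nat \<lfloor>6 * \<Lambda> / \<beta> * (ln (real n) / ln (1 / (1 - q1 * c * (q0 / (q0 + q1) - \<gamma>))))\<rfloor>) (x0 n))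
           {xs. \<exists>x\<in>set xs. consensus_on_one n x}"
      unfolding \<eta>_def[symmetric] \<Lambda>_def[symmetric]
      by (rule main[of n "d n" _ lam]) (use fam lam start n in \<open>auto simp: expander_family_def\<close>)
  qed (use \<kappa> \<kappa>1 \<beta> \<Lambda> in auto)
qed

end
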